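(* Let $S$ be the unique formal power series in the variables $t_1,t_2,\dots$ satisfying $S=1+\sum_{n=1}^\infty t_nS^n$, let $S_1=\sum_{n=1}^\infty t_n$, and let $G=(S-1)/S_1$ (the Geode). Then $G$ is the generating function for nonnegative paths, i.e. $G=\sum_P w(P)$, where the sum is over all nonnegative paths $P$ with steps in $\{-1,0,1,2,\dots\}$ and $w(P)$ is the weight of $P$.
   Context: A path is a finite (possibly empty) sequence $(s_1,\dots,s_k)$ of integers, called its steps; here all steps are in $\{-1,0,1,2,\dots\}$. A path is nonnegative if every partial sum $s_1+\cdots+s_i$ ($0\le i\le k$) is nonnegative. The weight of a step $n\ge 0$ is $t_{n+1}$, the weight of the step $-1$ is $1$, and the weight $w(P)$ of a path $P$ is the product of the weights of its steps (the empty path has weight $1$). The generating function for a set of paths is the sum of their weights, as a formal power series in the infinitely many commuting variables $t_1,t_2,\dots$ (arbitrary formal, possibly infinite, linear combinations of monomials). The ring of such power series (over the integers or the rationals) is an integral domain, and $G$ is defined a priori as an element of its field of fractions. *)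

theory Defs
  imports
    "HOL-Library.Multiset_Order"
    "HOL-Computational_Algebra.Polynomial_Factorial"
begin

section \<open>Formal power series in infinitely many variables\<close>

text \<open>
  A power series assigns an arbitrary coefficient to every monomial in countably many
  commuting variables.  A monomial is a finite multiset of variable indices,
  so multiplication of monomials is addition of multisets.
\<close>

typedef 'a ips = "UNIV :: (nat multiset \<Rightarrow> 'a) set"
  morphisms coeff_ips Abs_ips by simp

setup_lifting type_definition_ips

lemma ips_eqI: "(\<And>m. coeff_ips f m = coeff_ips g m) \<Longrightarrow> f = g"
  by (metis coeff_ips_inject ext)

lemma coeff_Abs_ips [simp]: "coeff_ips (Abs_ips f) = f"
  by (simp add: Abs_ips_inverse)

definition splits :: "nat multiset \<Rightarrow> (nat multiset \<times> nat multiset) set" where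
  "splits m = {(a, b). a + b = m}"

lemma finite_submultisets: "finite {a. a \<subseteq># (m :: 'v multiset)}"
proof (induction m)
  case (add x m)
  have "{a. a \<subseteq># add_mset x m} \<subseteq> {a. a \<subseteq># m} \<union> add_mset x ` {a. a \<subseteq># m}"
  proof
    fix a assume a: "a \<in> {a. a \<subseteq># add_mset x m}"
    show "a \<in> {a. a \<subseteq># m} \<union> add_mset x ` {a. a \<subseteq># m}"
    proof (cases "x \<in># a")
      case True
      then obtain b where "a = add_mset x b" by (metis insert_DiffM)
      with a show ?thesis by auto
    next
      case False
      with a show ?thesis
        by (auto simp: subset_mset.le_iff_add)
          (metis Diff_eq_empty_iff_mset a add_mset_remove_trivial diff_single_trivial
            mem_Collect_eq subset_eq_diff_conv subset_mset.le_iff_add union_iff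
            add_mset_add_single)
    qed
  qed
  with add show ?case by (meson finite_UnI finite_imageI finite_subset)
qed simp

lemma finite_splits [simp]: "finite (splits m)"
proof (rule finite_subset)
  show "splits m \<subseteq> {a. a \<subseteq># m} \<times> {a. a \<subseteq># m}"
    by (auto simp: splits_def)
qed (simp add: finite_submultisets)

lemma splits_empty [simp]: "splits {#} = {({#}, {#})}"
  by (auto simp: splits_def)

instantiation ips :: (comm_ring_1) comm_ring_1
begin

lift_definition zero_ips :: "'a ips" is "\<lambda>_. 0" .
lift_definition one_ips :: "'a ips" is "\<lambda>m. if m = {#} then 1 else 0" .
lift_definition plus_ips :: "'a ips \<Rightarrow> 'a ips \<Rightarrow> 'a ips" is "\<lambda>f g m. f m + g m" .
lift_definition minus_ips :: "'a ips \<Rightarrow> 'a ips \<Rightarrow> 'a ips" is "\<lambda>f g m. f m - g m" .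
lift_definition uminus_ips :: "'a ips \<Rightarrow> 'a ips" is "\<lambda>f m. - f m" .
lift_definition times_ips :: "'a ips \<Rightarrow> 'a ips \<Rightarrow> 'a ips"
  is "\<lambda>f g m. \<Sum>(a, b)\<in>splits m. f a * g b" .

instance
proof
  fix f g h :: "'a ips"
  show "f * g * h = f * (g * h)"
  proof (transfer, rule ext)
    fix f g h :: "nat multiset \<Rightarrow> 'a" and m
    have "(\<Sum>(x, c)\<in>splits m. (\<Sum>(a, b)\<in>splits x. f a * g b) * h c) =
          (\<Sum>((x, c), (a, b))\<in>Sigma (splits m) (\<lambda>(x, c). splits x). f a * g b * h c)"
      by (simp add: sum.Sigma sum_distrib_right case_prod_unfold)
    also have "\<dots> = (\<Sum>((a, y), (b, c))\<in>Sigma (splits m) (\<lambda>(a, y). splits y). f a * (g b * h c))"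
      by (rule sum.reindex_bij_witness
            [where i = "\<lambda>((a, y), (b, c)). ((a + b, c), (a, b))"
               and j = "\<lambda>((x, c), (a, b)). ((a, b + c), (b, c))"])
         (auto simp: splits_def algebra_simps)
    also have "\<dots> = (\<Sum>(a, y)\<in>splits m. f a * (\<Sum>(b, c)\<in>splits y. g b * h c))"
      by (simp add: sum.Sigma sum_distrib_left case_prod_unfold)
    finally show "(\<Sum>(x, c)\<in>splits m. (\<Sum>(a, b)\<in>splits x. f a * g b) * h c) =
                  (\<Sum>(a, y)\<in>splits m. f a * (\<Sum>(b, c)\<in>splits y. g b * h c))" .
  qed
  show "f * g = g * f"
  proof (transfer, rule ext)
    fix f g :: "nat multiset \<Rightarrow> 'a" and m
    show "(\<Sum>(a, b)\<in>splits m. f a * g b) = (\<Sum>(a, b)\<in>splits m. g a * f b)"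
      by (rule sum.reindex_bij_witness[where i = prod.swap and j = prod.swap])
         (auto simp: splits_def algebra_simps)
  qed
  show "1 * f = f"
  proof (transfer, rule ext)
    fix f :: "nat multiset \<Rightarrow> 'a" and m
    have "(\<Sum>(a, b)\<in>splits m. (if a = {#} then 1 else 0) * f b) =
          (\<Sum>(a, b)\<in>{({#} :: nat multiset, m)}. (if a = {#} then 1 else 0) * f b)"
      by (rule sum.mono_neutral_right)
         (auto simp: finite_splits[unfolded splits_def] splits_def split: if_splits)
    then show "(\<Sum>(a, b)\<in>splits m. (if a = {#} then 1 else 0) * f b) = f m" by simp
  qed
  show "(f + g) * h = f * h + g * h"
    by transfer (simp add: sum.distrib distrib_right case_prod_unfold)
  show "(0 :: 'a ips) \<noteq> 1"
    by transfer (auto simp: fun_eq_iff)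
qed (transfer; simp add: algebra_simps)+

end

lemma coeff_0 [simp]: "coeff_ips 0 m = 0" by transfer simp
lemma coeff_1: "coeff_ips 1 m = (if m = {#} then 1 else 0)" by transfer simp
lemma coeff_add [simp]: "coeff_ips (f + g) m = coeff_ips f m + coeff_ips g m" by transfer simp
lemma coeff_diff [simp]: "coeff_ips (f - g) m = coeff_ips f m - coeff_ips g m" by transfer simp
lemma coeff_mult: "coeff_ips (f * g) m = (\<Sum>(a, b)\<in>splits m. coeff_ips f a * coeff_ips g b)"
  by transfer simp

text \<open>No zero divisors: multiply the least monomials of the two factors, for the
  multiset order, which is a well-order compatible with addition.\<close>

instance ips :: (idom) idom
proof
  fix f g :: "'a ips"
  assume "f \<noteq> 0" "g \<noteq> 0"
  then have ex: "\<exists>m. coeff_ips f m \<noteq> 0" "\<exists>m. coeff_ips g m \<noteq> 0"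
    by (metis coeff_0 ips_eqI)+
  define p where "p = (LEAST m. coeff_ips f m \<noteq> 0)"
  define q where "q = (LEAST m. coeff_ips g m \<noteq> 0)"
  have p: "coeff_ips f p \<noteq> 0" "\<And>m. m < p \<Longrightarrow> coeff_ips f m = 0"
    and q: "coeff_ips g q \<noteq> 0" "\<And>m. m < q \<Longrightarrow> coeff_ips g m = 0"
    using LeastI_ex[OF ex(1)] LeastI_ex[OF ex(2)] not_less_Least
    unfolding p_def q_def by blast+
  have "coeff_ips (f * g) (p + q) = (\<Sum>(a, b)\<in>{(p, q)}. coeff_ips f a * coeff_ips g b)"
    unfolding coeff_mult
  proof (rule sum.mono_neutral_right)
    show "\<forall>i\<in>splits (p + q) - {(p, q)}. (case i of (a, b) \<Rightarrow> coeff_ips f a * coeff_ips g b) = 0"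
    proof
      fix i assume i: "i \<in> splits (p + q) - {(p, q)}"
      obtain a b where iab: "i = (a, b)" by fastforce
      with i have ab: "(a, b) \<in> splits (p + q)" "(a, b) \<notin> {(p, q)}" by auto
      then have eq: "a + b = p + q" by (simp add: splits_def)
      have "a < p \<or> b < q"
      proof (rule ccontr)
        assume "\<not> (a < p \<or> b < q)"
        then have le: "p \<le> a" "q \<le> b" by auto
        show False
        proof (cases "p = a")
          case True
          with eq ab show False by simp
        next
          case False
          with le have "p < a" by simp
          then have "p + q < a + b" using le(2) by (rule add_less_le_mono)
          with eq show False by simp
        qed
      qed
      then show "(case i of (a, b) \<Rightarrow> coeff_ips f a * coeff_ips g b) = 0"
        using p q iab by auto
    qed
  qed (simp, simp add: splits_def)
  also have "\<dots> \<noteq> 0" using p q by simp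
  finally show "f * g \<noteq> 0" by auto
qed

subsection \<open>Formal infinite sums\<close>

definition fsummable :: "('b \<Rightarrow> 'a::comm_ring_1 ips) \<Rightarrow> 'b set \<Rightarrow> bool" where
  "fsummable f A \<longleftrightarrow> (\<forall>m. finite {x \<in> A. coeff_ips (f x) m \<noteq> 0})"

text \<open>Only meaningful if \<^term>\<open>fsummable f A\<close>, which is shown below for
  every sum used.\<close>

definition fsum :: "('b \<Rightarrow> 'a::comm_ring_1 ips) \<Rightarrow> 'b set \<Rightarrow> 'a ips" where
  "fsum f A = Abs_ips (\<lambda>m. \<Sum>x | x \<in> A \<and> coeff_ips (f x) m \<noteq> 0. coeff_ips (f x) m)"

subsection \<open>The variables\<close>

text \<open>The variables are \<open>t\<^sub>1, t\<^sub>2, \<dots>\<close>, where \<open>t\<^sub>n\<close> has index \<open>n - 1\<close> in monomials;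
  so \<^term>\<open>tvar n\<close> is only used for \<open>n \<ge> 1\<close>, and no superfluous variable \<open>t\<^sub>0\<close> is present
  in the ring.\<close>

definition tvar :: "nat \<Rightarrow> 'a::comm_ring_1 ips" where
  "tvar n = Abs_ips (\<lambda>m. if m = {#n - 1#} then 1 else 0)"

lemma coeff_tvar: "coeff_ips (tvar n) m = (if m = {#n - 1#} then 1 else 0)"
  by (simp add: tvar_def)

lemma coeff_tvar_mult:
  "coeff_ips (tvar n * f) m = (if n - 1 \<in># m then coeff_ips f (m - {#n - 1#}) else 0)"
proof -
  have "coeff_ips (tvar n * f) m =
        (\<Sum>(a, b)\<in>(if n - 1 \<in># m then {({#n - 1#}, m - {#n - 1#})} else {}).
          coeff_ips (tvar n) a * coeff_ips f b)"
    unfolding coeff_mult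
    by (rule sum.mono_neutral_right) (auto simp: finite_splits[unfolded splits_def] splits_def coeff_tvar split: if_splits)
  then show ?thesis by (simp add: coeff_tvar)
qed

lemma fsummable_tvar_mult: "fsummable (\<lambda>n. tvar n * f n) {1..}"
  unfolding fsummable_def
proof
  fix m
  show "finite {n \<in> {1..}. coeff_ips (tvar n * f n) m \<noteq> 0}"
    by (rule finite_subset[of _ "Suc ` set_mset m"])
       (force simp: coeff_tvar_mult image_iff split: if_splits)+
qed

lemma fsummable_tvar: "fsummable tvar {1..}"
  using fsummable_tvar_mult[of "\<lambda>_. 1"] by simp

section \<open>The Geode\<close>

definition S_series :: "'a::comm_ring_1 ips" where
  "S_series = (THE S. S = 1 + fsum (\<lambda>n. tvar n * S ^ n) {1..})"

definition S1_series :: "'a::comm_ring_1 ips" where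
  "S1_series = fsum tvar {1..}"

definition Geode :: "'a::idom ips fract" where
  "Geode = to_fract (S_series - 1) / to_fract S1_series"

text \<open>Existence and uniqueness of the solution defining \<^const>\<open>S_series\<close>: the right hand side of
  the equation is a contraction with respect to agreement in low degrees.\<close>

definition agree :: "nat \<Rightarrow> 'a::comm_ring_1 ips \<Rightarrow> 'a ips \<Rightarrow> bool" where
  "agree k f g \<longleftrightarrow> (\<forall>m. size m < k \<longrightarrow> coeff_ips f m = coeff_ips g m)"

lemma agree_mult:
  assumes "agree k f f'" "agree k g g'"
  shows "agree k (f * g) (f' * g')"
  unfolding agree_def coeff_mult
proof (intro allI impI sum.cong refl)
  fix m x assume "size m < k" "x \<in> splits m"
  then show "(case x of (a, b) \<Rightarrow> coeff_ips f a * coeff_ips g b) =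
             (case x of (a, b) \<Rightarrow> coeff_ips f' a * coeff_ips g' b)"
    using assms by (auto simp: splits_def agree_def)
qed

lemma agree_power: "agree k f g \<Longrightarrow> agree k (f ^ n) (g ^ n)"
  by (induction n) (auto intro: agree_mult simp: agree_def[of _ 1 1])

lemma agree_step:
  assumes "agree k S T"
  shows "agree (Suc k) (1 + fsum (\<lambda>n. tvar n * S ^ n) {1..}) (1 + fsum (\<lambda>n. tvar n * T ^ n) {1..})"
proof -
  have "coeff_ips (tvar n * S ^ n) m = coeff_ips (tvar n * T ^ n) m" if "size m < Suc k" for m n
  proof (cases "n - 1 \<in># m")
    case True
    then have "size (m - {#n - 1#}) < k" using that
      by (metis Suc_less_eq insert_DiffM size_add_mset)
    then show ?thesis using agree_power[OF assms, of n] by (simp add: coeff_tvar_mult agree_def)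
  qed (simp add: coeff_tvar_mult)
  then show ?thesis by (simp add: agree_def fsum_def)
qed

theorem S_series_ex1: "\<exists>!S :: 'a::comm_ring_1 ips. S = 1 + fsum (\<lambda>n. tvar n * S ^ n) {1..}"
proof -
  define F where "F = (\<lambda>S :: 'a ips. 1 + fsum (\<lambda>n. tvar n * S ^ n) {1..})"
  have step: "agree (Suc k) (F S) (F T)" if "agree k S T" for k S T
    unfolding F_def by (rule agree_step) (rule that)
  have coherent: "agree k ((F ^^ k) S) ((F ^^ k) T)" for k S T
    by (induction k) (auto simp: step, simp add: agree_def)
  have eqI: "S = T" if "\<And>k. agree k S T" for S T :: "'a ips"
    using that by (intro ips_eqI) (metis agree_def lessI)
  define L where "L = Abs_ips (\<lambda>m. coeff_ips ((F ^^ Suc (size m)) 0) m)"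
  have L: "agree k L ((F ^^ k) 0)" for k
    unfolding agree_def
  proof (intro allI impI)
    fix m :: "nat multiset" assume "size m < k"
    then obtain d where d: "k = Suc (size m) + d"
      using less_iff_Suc_add[of "size m" k] by auto
    have "coeff_ips L m = coeff_ips ((F ^^ Suc (size m)) 0) m" by (simp add: L_def)
    also have "\<dots> = coeff_ips ((F ^^ Suc (size m)) ((F ^^ d) 0)) m"
      using coherent[of "Suc (size m)" 0 "(F ^^ d) 0"] unfolding agree_def by blast
    also have "(F ^^ Suc (size m)) ((F ^^ d) 0) = (F ^^ k) 0"
      unfolding d funpow_add by simp
    finally show "coeff_ips L m = coeff_ips ((F ^^ k) 0) m" .
  qed
  have "agree k L (F L)" for k
  proof -
    have "agree (Suc k) L ((F ^^ Suc k) 0)" by (rule L)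
    moreover have "agree (Suc k) (F L) ((F ^^ Suc k) 0)" using step[OF L[of k]] by simp
    ultimately show ?thesis by (auto simp: agree_def)
  qed
  then have "L = F L" by (rule eqI)
  moreover have "S = T" if "S = F S" "T = F T" for S T
  proof (rule eqI)
    fix k
    have "(F ^^ k) S = S" "(F ^^ k) T = T"
      by (induction k) (use that in \<open>simp_all flip: that\<close>)
    then show "agree k S T" using coherent[of k S T] by simp
  qed
  ultimately show ?thesis unfolding F_def by blast
qed

lemma S_series_eq: "S_series = 1 + fsum (\<lambda>n. tvar n * S_series ^ n) {1..}"
  unfolding S_series_def by (rule theI') (rule S_series_ex1)

lemma S1_series_nonzero: "S1_series \<noteq> 0"
proof -
  have "{n. n \<in> {1..} \<and> coeff_ips (tvar n :: 'a ips) {#0#} \<noteq> 0} = {1}"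
    by (auto simp: coeff_tvar split: if_splits)
  then have "coeff_ips (S1_series :: 'a ips) {#0#} = 1"
    by (simp add: S1_series_def fsum_def) (simp add: coeff_tvar)
  then show ?thesis by auto
qed

section \<open>Paths\<close>

definition is_path :: "int list \<Rightarrow> bool" where
  "is_path P \<longleftrightarrow> (\<forall>s\<in>set P. s \<ge> -1)"

definition nonneg_paths :: "int list set" where
  "nonneg_paths = {P. is_path P \<and> (\<forall>i\<le>length P. sum_list (take i P) \<ge> 0)}"

definition step_weight :: "int \<Rightarrow> 'a::comm_ring_1 ips" where
  "step_weight s = (if s = -1 then 1 else tvar (nat s + 1))"

definition path_weight :: "int list \<Rightarrow> 'a::comm_ring_1 ips" where
  "path_weight P = prod_list (map step_weight P)"

definition gen_fun :: "int list set \<Rightarrow> 'a::comm_ring_1 ips" where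
  "gen_fun A = fsum path_weight A"

lemma coeff_path_weight:
  assumes "is_path P"
  shows "coeff_ips (path_weight P) m =
         (if m = mset (map nat (filter (\<lambda>s. s \<ge> 0) P)) then 1 else 0)"
  using assms
proof (induction P arbitrary: m)
  case (Cons s P)
  then have P: "is_path P" and s: "s = -1 \<or> s \<ge> 0" by (auto simp: is_path_def)
  show ?case
  proof (cases "s = -1")
    case True
    with Cons.IH[OF P] show ?thesis by (simp add: path_weight_def step_weight_def)
  next
    case False
    with s have "s \<ge> 0" by simp
    have "coeff_ips (path_weight (s # P)) m =
          (if nat s \<in># m then coeff_ips (path_weight P) (m - {#nat s#}) else 0)"
      using False by (simp add: path_weight_def step_weight_def coeff_tvar_mult)
    with Cons.IH[OF P] \<open>s \<ge> 0\<close> show ?thesis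
      by (cases "nat s \<in># m") (auto dest!: multi_member_split)
  qed
qed (simp add: path_weight_def coeff_1)

lemma path_sum_length:
  "is_path P \<Longrightarrow> sum_list P + int (length P) =
     int (sum_list (map nat (filter (\<lambda>s. s \<ge> 0) P))) + int (length (filter (\<lambda>s. s \<ge> 0) P))"
  by (induction P) (auto simp: is_path_def)

lemma fsummable_path_weight: "fsummable path_weight nonneg_paths"
  unfolding fsummable_def
proof
  fix m :: "nat multiset"
  let ?U = "insert (-1) (int ` set_mset m)"
  show "finite {P \<in> nonneg_paths. coeff_ips (path_weight P :: 'a ips) m \<noteq> 0}"
  proof (rule finite_subset)
    show "{P \<in> nonneg_paths. coeff_ips (path_weight P :: 'a ips) m \<noteq> 0}
          \<subseteq> {P. set P \<subseteq> ?U \<and> length P \<le> sum_mset m + size m}"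
    proof clarify
      fix P assume P: "P \<in> nonneg_paths" "coeff_ips (path_weight P :: 'a ips) m \<noteq> 0"
      then have path: "is_path P" and nn: "sum_list (take (length P) P) \<ge> 0"
        by (auto simp: nonneg_paths_def)
      with P have m: "m = mset (map nat (filter (\<lambda>s. s \<ge> 0) P))"
        by (simp add: coeff_path_weight split: if_splits)
      have "set P \<subseteq> ?U"
      proof
        fix s assume s: "s \<in> set P"
        show "s \<in> ?U"
        proof (cases "s \<ge> 0")
          case True
          with s have "nat s \<in># m" unfolding m by auto
          with True show ?thesis by (auto simp: image_iff intro: bexI[of _ "nat s"])
        next
          case False
          with s path show ?thesis by (force simp: is_path_def)
        qed
      qed
      moreover have "length P \<le> sum_mset m + size m"
        using path_sum_length[OF path] nn unfolding m sum_mset_sum_list size_mset by simp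
      ultimately show "set P \<subseteq> ?U \<and> length P \<le> sum_mset m + size m" ..
    qed
  qed (simp add: finite_lists_length_le)
qed

end

theory Submission
  imports Defs
begin

text \<open>
  Let \<open>G\<^sub>k\<close> be the generating function for paths that remain nonnegative when started at
  height \<open>k\<close>.  Splitting off the first step gives
  \<open>G\<^sub>k = 1 + G\<^sub>k\<^sub>-\<^sub>1 + \<Sum>\<^sub>n t\<^sub>n G\<^sub>k\<^sub>+\<^sub>n\<^sub>-\<^sub>1\<close>, where \<open>G\<^sub>-\<^sub>1 = 0\<close>.  By the equation for \<open>S\<close>, the series
  \<open>S\<^sup>k\<^sup>+\<^sup>1 - 1\<close> satisfy the same recurrence with the inhomogeneous term \<open>1\<close> replaced by \<open>S\<^sub>1\<close>, and so
  do the series \<open>S\<^sub>1 G\<^sub>k\<close>.  The recurrence determines its solution, by induction on the degree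
  and then on \<open>k\<close>.  Hence \<open>S\<^sub>1 G\<^sub>k = S\<^sup>k\<^sup>+\<^sup>1 - 1\<close> for all \<open>k\<close>, and \<open>k = 0\<close> is the claim.
\<close>

section \<open>Linear combinations of the variables\<close>

definition tvar_sum :: "(nat \<Rightarrow> 'a::comm_ring_1 ips) \<Rightarrow> 'a ips" where
  "tvar_sum f = fsum (\<lambda>n. tvar n * f n) {1..}"

lemma coeff_sum: "coeff_ips (sum f A) m = (\<Sum>x\<in>A. coeff_ips (f x) m)"
  by (induction A rule: infinite_finite_induct) simp_all

text \<open>Only variables dividing \<open>m\<close> contribute. Allowing a larger \<open>A\<close>
  lets one finite sum serve all divisors of a given monomial at once.\<close>

lemma coeff_tvar_sum_eq_sum:
  assumes "finite A" "A \<subseteq> {1..}" "Suc ` set_mset m \<subseteq> A"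
  shows "coeff_ips (tvar_sum f) m = coeff_ips (\<Sum>n\<in>A. tvar n * f n) m"
proof -
  have "n \<in> A" if "n \<ge> 1" "coeff_ips (tvar n * f n) m \<noteq> 0" for n
  proof -
    have "n - 1 \<in># m" using that by (auto simp: coeff_tvar_mult split: if_splits)
    then have "Suc (n - 1) \<in> A" using assms by blast
    with that show ?thesis by simp
  qed
  then show ?thesis
    unfolding tvar_sum_def fsum_def coeff_sum coeff_Abs_ips
    by (intro sum.mono_neutral_left) (use assms in auto)
qed

lemma coeff_tvar_sum:
  "coeff_ips (tvar_sum f) m = (\<Sum>j\<in>set_mset m. coeff_ips (f (Suc j)) (m - {#j#}))"
  by (subst coeff_tvar_sum_eq_sum[where A = "Suc ` set_mset m"])
     (auto simp: coeff_sum sum.reindex coeff_tvar_mult)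

lemma tvar_sum_diff: "tvar_sum (\<lambda>n. f n - g n) = tvar_sum f - tvar_sum g"
  by (rule ips_eqI) (simp add: coeff_tvar_sum sum_subtractf)

text \<open>A product's coefficient at \<open>m\<close> uses its factors only at divisors of
  \<open>m\<close>, so the finite sum \<open>?s\<close> may replace the infinite one and finite
  distributivity applies.\<close>

lemma tvar_sum_mult: "tvar_sum (\<lambda>n. c * f n) = c * tvar_sum f"
proof (rule ips_eqI)
  fix m
  let ?A = "Suc ` set_mset m"
  let ?s = "\<Sum>n\<in>?A. tvar n * f n"
  have "coeff_ips (c * tvar_sum f) m = coeff_ips (c * ?s) m"
    unfolding coeff_mult
  proof (intro sum.cong refl)
    fix x assume "x \<in> splits m"
    then obtain a b where x: "x = (a, b)" "a + b = m" by (auto simp: splits_def)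
    then have "coeff_ips (tvar_sum f) b = coeff_ips ?s b"
      by (intro coeff_tvar_sum_eq_sum) auto
    then show "(case x of (a, b) \<Rightarrow> coeff_ips c a * coeff_ips (tvar_sum f) b) =
               (case x of (a, b) \<Rightarrow> coeff_ips c a * coeff_ips ?s b)"
      by (simp add: x)
  qed
  also have "c * ?s = (\<Sum>n\<in>?A. tvar n * (c * f n))"
    by (simp add: sum_distrib_left mult.left_commute)
  also have "coeff_ips \<dots> m = coeff_ips (tvar_sum (\<lambda>n. c * f n)) m"
    by (intro coeff_tvar_sum_eq_sum[symmetric]) auto
  finally show "coeff_ips (tvar_sum (\<lambda>n. c * f n)) m = coeff_ips (c * tvar_sum f) m" by simp
qed

lemma S1_series_eq_tvar_sum: "S1_series = tvar_sum (\<lambda>_. 1)"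
  by (simp add: S1_series_def tvar_sum_def)

lemma S_series_eq_tvar_sum: "S_series = 1 + tvar_sum (\<lambda>n. S_series ^ n)"
  unfolding tvar_sum_def by (rule S_series_eq)

text \<open>The variables inside \<open>tvar_sum\<close> lower the degree, so its terms are settled
  at every height by the outer induction. The term at \<open>k - 1\<close> keeps the monomial and
  needs the inner induction on \<open>k\<close>.\<close>

lemma first_step_recurrence_unique:
  fixes f g :: "nat \<Rightarrow> 'a::comm_ring_1 ips"
  assumes f: "\<And>k. f k = c + (if k = 0 then 0 else f (k - 1)) + tvar_sum (\<lambda>n. f (k + n - 1))"
    and g: "\<And>k. g k = c + (if k = 0 then 0 else g (k - 1)) + tvar_sum (\<lambda>n. g (k + n - 1))"
  shows "f k = g k"
proof (rule ips_eqI)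
  fix m
  show "coeff_ips (f k) m = coeff_ips (g k) m"
  proof (induction "size m" arbitrary: m k rule: less_induct)
    case less
    have tails: "coeff_ips (tvar_sum (\<lambda>n. f (k + n - 1))) m =
        coeff_ips (tvar_sum (\<lambda>n. g (k + n - 1))) m" for k
      unfolding coeff_tvar_sum by (intro sum.cong refl less size_Diff1_less)
    show ?case
    proof (induction k)
      case 0
      show ?case using tails[of 0] by (simp add: f[of 0] g[of 0])
    next
      case (Suc k)
      then show ?case using tails[of "Suc k"] by (simp add: f[of "Suc k"] g[of "Suc k"])
    qed
  qed
qed

section \<open>Paths with a given starting height\<close>

definition nonneg_paths_from :: "nat \<Rightarrow> int list set" where
  "nonneg_paths_from k =
     {P. is_path P \<and> (\<forall>i\<le>length P. int k + sum_list (take i P) \<ge> 0)}"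

lemma nonneg_paths_from_0: "nonneg_paths_from 0 = nonneg_paths"
  by (simp add: nonneg_paths_from_def nonneg_paths_def)

lemma Nil_in_nonneg_paths_from [simp]: "[] \<in> nonneg_paths_from k"
  by (simp add: nonneg_paths_from_def is_path_def)

lemma Cons_in_nonneg_paths_from:
  "s # P \<in> nonneg_paths_from k \<longleftrightarrow>
     s \<ge> -1 \<and> int k + s \<ge> 0 \<and> P \<in> nonneg_paths_from (nat (int k + s))"
proof -
  have "(\<forall>i\<le>length (s # P). int k + sum_list (take i (s # P)) \<ge> 0) \<longleftrightarrow>
        (\<forall>i\<le>length P. int k + s + sum_list (take i P) \<ge> 0)"
    by (simp add: All_less_Suc2 flip: less_Suc_eq_le add.assoc)
  \<comment> \<open>The instance \<open>i = 0\<close> gives the bound under which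
    \<open>nat (int k + s)\<close> is the true new height.\<close>
  moreover have "int k + s \<ge> 0"
    if "\<forall>i\<le>length P. int k + s + sum_list (take i P) \<ge> 0"
    using that[rule_format, of 0] by simp
  ultimately show ?thesis
    by (auto simp: nonneg_paths_from_def is_path_def)
qed

text \<open>A step \<open>s \<ge> 0\<close> weighs \<open>tvar (nat s + 1)\<close>, whose index in
  monomials is \<open>nat s\<close>, so no shift appears.\<close>

definition path_monomial :: "int list \<Rightarrow> nat multiset" where
  "path_monomial P = mset (map nat (filter (\<lambda>s. s \<ge> 0) P))"

lemma path_monomial_simps [simp]:
  "path_monomial [] = {#}"
  "path_monomial (-1 # P) = path_monomial P"
  "path_monomial (int j # P) = add_mset j (path_monomial P)"
  by (simp_all add: path_monomial_def)

definition monomial_paths :: "nat \<Rightarrow> nat multiset \<Rightarrow> int list set" where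
  "monomial_paths k m = {P \<in> nonneg_paths_from k. path_monomial P = m}"

lemma coeff_path_weight_nonneg_paths_from:
  assumes "P \<in> nonneg_paths_from k"
  shows "coeff_ips (path_weight P) m = (if path_monomial P = m then 1 else 0)"
  using assms coeff_path_weight[of P m] by (auto simp: nonneg_paths_from_def path_monomial_def)

text \<open>Each path weighs a single monomial with coefficient 1, so recurrences for the series
  reduce to counting paths.\<close>

lemma coeff_gen_fun_nonneg_paths_from:
  "coeff_ips (gen_fun (nonneg_paths_from k) :: 'a::comm_ring_1 ips) m =
     of_nat (card (monomial_paths k m))"
proof -
  have "{P \<in> nonneg_paths_from k. coeff_ips (path_weight P :: 'a ips) m \<noteq> 0} = monomial_paths k m"
    by (auto simp: monomial_paths_def coeff_path_weight_nonneg_paths_from split: if_splits)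
  moreover have "coeff_ips (path_weight P :: 'a ips) m = 1" if "P \<in> monomial_paths k m" for P
    using that by (auto simp: monomial_paths_def coeff_path_weight_nonneg_paths_from)
  ultimately show ?thesis by (simp add: gen_fun_def fsum_def)
qed

lemma finite_monomial_paths: "finite (monomial_paths k m)"
proof -
  \<comment> \<open>Prepending the step \<open>k\<close> reduces to the case of starting height \<open>0\<close>.\<close>
  have "(#) (int k) ` monomial_paths k m
        \<subseteq> {P \<in> nonneg_paths. coeff_ips (path_weight P :: int ips) (add_mset k m) \<noteq> 0}"
  proof clarify
    fix P assume P: "P \<in> monomial_paths k m"
    then have "int k # P \<in> nonneg_paths_from 0"
      by (simp add: Cons_in_nonneg_paths_from monomial_paths_def)
    with P show "int k # P \<in> nonneg_paths \<and>
        coeff_ips (path_weight (int k # P) :: int ips) (add_mset k m) \<noteq> 0"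
      by (simp add: coeff_path_weight_nonneg_paths_from monomial_paths_def flip: nonneg_paths_from_0)
  qed
  then have "finite ((#) (int k) ` monomial_paths k m)"
    using fsummable_path_weight[where 'a = int] finite_subset unfolding fsummable_def by blast
  then show ?thesis by (rule finite_imageD) simp
qed

lemma Nil_in_monomial_paths: "[] \<in> monomial_paths k m \<longleftrightarrow> m = {#}"
  by (auto simp: monomial_paths_def)

lemma Cons_minus_1_in_monomial_paths:
  "-1 # P \<in> monomial_paths k m \<longleftrightarrow> k \<noteq> 0 \<and> P \<in> monomial_paths (k - 1) m"
  by (cases k) (simp_all add: monomial_paths_def Cons_in_nonneg_paths_from)

lemma Cons_int_in_monomial_paths:
  "int j # P \<in> monomial_paths k m \<longleftrightarrow> j \<in># m \<and> P \<in> monomial_paths (k + j) (m - {#j#})"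
proof -
  have "nat (int k + int j) = k + j" by simp
  moreover have "add_mset j M = m \<longleftrightarrow> j \<in># m \<and> M = m - {#j#}" for M
    by (metis add_mset_remove_trivial insert_DiffM union_single_eq_member)
  ultimately show ?thesis
    by (simp add: monomial_paths_def Cons_in_nonneg_paths_from conj_ac)
qed

lemma monomial_paths_first_step:
  "monomial_paths k m =
     (if m = {#} then {[]} else {})
     \<union> (if k = 0 then {} else (#) (-1) ` monomial_paths (k - 1) m)
     \<union> (\<Union>j\<in>set_mset m. (#) (int j) ` monomial_paths (k + j) (m - {#j#}))"
  (is "_ = ?R")
proof (rule set_eqI)
  fix P
  \<comment> \<open>The last case, an illegal first step, makes the analysis exhaustive; such a list
    lies in neither set.\<close>
  consider "P = []" | P' where "P = -1 # P'" | j P' where "P = int j # P'"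
    | s P' where "P = s # P'" "s < -1"
  proof (cases P)
    case (Cons s P')
    then show thesis using that nonneg_int_cases[of s] by (cases "s \<ge> 0"; cases "s = -1") auto
  qed
  then show "P \<in> monomial_paths k m \<longleftrightarrow> P \<in> ?R"
  proof cases
    case 1
    then show ?thesis by (simp add: Nil_in_monomial_paths image_iff)
  next
    case (2 P')
    then show ?thesis by (simp add: Cons_minus_1_in_monomial_paths image_iff)
  next
    case (3 j P')
    then show ?thesis by (simp add: Cons_int_in_monomial_paths image_iff)
  next
    case (4 s P')
    then show ?thesis
      by (auto simp: monomial_paths_def Cons_in_nonneg_paths_from)
  qed
qed

text \<open>The pieces of the decomposition are disjoint because first steps differ, and prepending
  a step is injective.\<close>

lemma card_monomial_paths:
  "card (monomial_paths k m) =
     (if m = {#} then 1 else 0)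
     + (if k = 0 then 0 else card (monomial_paths (k - 1) m))
     + (\<Sum>j\<in>set_mset m. card (monomial_paths (k + j) (m - {#j#})))"
proof -
  let ?A = "if m = {#} then {[]} else {} :: int list set"
  let ?B = "if k = 0 then {} else (#) (-1) ` monomial_paths (k - 1) m"
  let ?C = "\<Union>j\<in>set_mset m. (#) (int j) ` monomial_paths (k + j) (m - {#j#})"
  have "card ?C = (\<Sum>j\<in>set_mset m. card ((#) (int j) ` monomial_paths (k + j) (m - {#j#})))"
    by (rule card_UN_disjoint) (auto simp: finite_monomial_paths)
  also have "\<dots> = (\<Sum>j\<in>set_mset m. card (monomial_paths (k + j) (m - {#j#})))"
    by (simp add: card_image)
  finally have C: "card ?C = \<dots>" .
  have B: "card ?B = (if k = 0 then 0 else card (monomial_paths (k - 1) m))"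
    by (simp add: card_image)
  have fin: "finite ?A" "finite ?B" "finite ?C" by (simp_all add: finite_monomial_paths)
  have "card (monomial_paths k m) = card (?A \<union> ?B \<union> ?C)"
    by (subst monomial_paths_first_step) (rule refl)
  also have "\<dots> = card (?A \<union> ?B) + card ?C"
    by (rule card_Un_disjoint) (use fin in auto)
  also have "card (?A \<union> ?B) = card ?A + card ?B"
    by (rule card_Un_disjoint) (use fin in auto)
  finally show ?thesis unfolding B C by simp
qed

lemma gen_fun_nonneg_paths_from_first_step:
  "(gen_fun (nonneg_paths_from k) :: 'a::comm_ring_1 ips) =
     1 + (if k = 0 then 0 else gen_fun (nonneg_paths_from (k - 1)))
     + tvar_sum (\<lambda>n. gen_fun (nonneg_paths_from (k + n - 1)))"
proof (rule ips_eqI)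
  fix m
  show "coeff_ips (gen_fun (nonneg_paths_from k) :: 'a ips) m =
    coeff_ips (1 + (if k = 0 then 0 else gen_fun (nonneg_paths_from (k - 1)))
      + tvar_sum (\<lambda>n. gen_fun (nonneg_paths_from (k + n - 1)))) m"
    \<comment> \<open>The step \<open>j\<close> matches the summand \<open>n = Suc j\<close>, where
      \<open>k + n - 1\<close> is \<open>k + j\<close>.\<close>
    by (subst coeff_gen_fun_nonneg_paths_from, subst card_monomial_paths)
       (simp add: coeff_tvar_sum coeff_gen_fun_nonneg_paths_from coeff_1)
qed

lemma S1_series_times_gen_fun_nonneg_paths_from:
  "S1_series * gen_fun (nonneg_paths_from k) = (S_series :: 'a::comm_ring_1 ips) ^ Suc k - 1"
proof (rule first_step_recurrence_unique[where c = S1_series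
      and f = "\<lambda>k. S1_series * gen_fun (nonneg_paths_from k)"
      and g = "\<lambda>k. S_series ^ Suc k - 1"])
  fix k
  let ?G = "\<lambda>k. gen_fun (nonneg_paths_from k) :: 'a ips"
  show "S1_series * ?G k =
    S1_series + (if k = 0 then 0 else S1_series * ?G (k - 1))
    + tvar_sum (\<lambda>n. S1_series * ?G (k + n - 1))"
    by (subst gen_fun_nonneg_paths_from_first_step) (simp add: tvar_sum_mult distrib_left)
next
  fix k
  let ?S = "S_series :: 'a ips"
  have "tvar_sum (\<lambda>n. ?S ^ Suc (k + n - 1) - 1) = tvar_sum (\<lambda>n. ?S ^ k * ?S ^ n - 1)"
    \<comment> \<open>The exponents \<open>Suc (k + n - 1)\<close> and \<open>k + n\<close> differ
      at \<open>k = n = 0\<close>; coefficients see only \<open>n = Suc j\<close>, where they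
      agree.\<close>
    by (rule ips_eqI) (simp add: coeff_tvar_sum power_add mult.left_commute)
  also have "\<dots> = ?S ^ k * tvar_sum (\<lambda>n. ?S ^ n) - S1_series"
    by (simp add: tvar_sum_diff tvar_sum_mult S1_series_eq_tvar_sum)
  also have "tvar_sum (\<lambda>n. ?S ^ n) = ?S - 1"
    using S_series_eq_tvar_sum[where 'a = 'a] by (metis add_diff_cancel_left')
  finally have "tvar_sum (\<lambda>n. ?S ^ Suc (k + n - 1) - 1) = ?S ^ Suc k - ?S ^ k - S1_series"
    by (simp add: algebra_simps)
  then show "?S ^ Suc k - 1 =
    S1_series + (if k = 0 then 0 else ?S ^ Suc (k - 1) - 1)
    + tvar_sum (\<lambda>n. ?S ^ Suc (k + n - 1) - 1)"
    \<comment> \<open>For \<open>k = 0\<close> the term \<open>?S ^ k - 1\<close> vanishes, matching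
      the boundary value 0.\<close>
    by (cases k) simp_all
qed

theorem theorem3p4:
  shows "(Geode :: 'a::idom ips fract) = to_fract (gen_fun nonneg_paths)"
proof -
  have "(S_series - 1 :: 'a ips) = S1_series * gen_fun nonneg_paths"
    using S1_series_times_gen_fun_nonneg_paths_from[of 0, where 'a = 'a]
    by (simp add: nonneg_paths_from_0)
  then show ?thesis
    by (simp add: Geode_def S1_series_nonzero)
qed

end
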